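(* Let $R$ be a ring. For the class of semisimple left $R$-modules, the following statements hold: (1) the completely prime radical $\beta_{co}$ is hereditary, i.e. $\beta_{co}(N)=N\cap\beta_{co}(M)$ for every semisimple module $M$ and every submodule $N$ of $M$; (2) the pair $\tau_{\beta_{co}}=(\mathcal{T}_{\beta_{co}},\mathcal{F}_{\beta_{co}})$, where $\mathcal{T}_{\beta_{co}}=\{M : M\text{ is semisimple and }\beta_{co}(M)=M\}$ and $\mathcal{F}_{\beta_{co}}=\{M : M\text{ is semisimple and }\beta_{co}(M)=\{0\}\}$, is a torsion theory (on the class of semisimple modules); (3) the completely prime radical is idempotent, i.e. $\beta_{co}(\beta_{co}(M))=\beta_{co}(M)$ for every semisimple module $M$.
   Context: Rings are associative and unital; modules are left unital modules. A left $R$-module $M$ with $RM\ne\{0\}$ is completely prime if for all $a\in R$ and $m\in M$, $am=0$ implies $m=0$ or $aM=\{0\}$. A submodule $P$ of $M$ is a completely prime submodule if $M/P$ is a completely prime module. The completely prime radical $\beta_{co}(M)$ is the intersection of all completely prime submodules of $M$, with $\beta_{co}(M)=M$ if $M$ has no completely prime submodules. A pair $(\mathcal{T},\mathcal{F})$ of classes of modules is a torsion theory on a class $\mathcal{C}$ of modules (with $\mathcal{T},\mathcal{F}\subseteq\mathcal{C}$) if: (i) $\mathrm{Hom}_R(T,F)=\{0\}$ for all $T\in\mathcal{T}$, $F\in\mathcal{F}$; (ii) if $C\in\mathcal{C}$ and $\mathrm{Hom}_R(C,F)=\{0\}$ for all $F\in\mathcal{F}$, then $C\in\mathcal{T}$;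 (iii) if $C\in\mathcal{C}$ and $\mathrm{Hom}_R(T,C)=\{0\}$ for all $T\in\mathcal{T}$, then $C\in\mathcal{F}$. *)

theory Defs
  imports "HOL-Algebra.Module" "HOL-Algebra.AbelCoset"
begin

text \<open>
  The library locale \<open>module\<close> requires a commutative ring of scalars. Here the ring is arbitrary;
  the axioms and the record type (whose fields \<open>mult\<close> and \<open>one\<close> play no role) are the same, and so
  is the library's notion \<open>submodule\<close>, which does not depend on commutativity.
\<close>

locale left_module = R?: ring R + M?: abelian_group M
  for R (structure) and M (structure) +
  assumes smult_closed [simp, intro]:
      "\<lbrakk>a \<in> carrier R; x \<in> carrier M\<rbrakk> \<Longrightarrow> a \<odot>\<^bsub>M\<^esub> x \<in> carrier M"
    and smult_l_distr:
      "\<lbrakk>a \<in> carrier R; b \<in> carrier R; x \<in> carrier M\<rbrakk> \<Longrightarrow>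
       (a \<oplus> b) \<odot>\<^bsub>M\<^esub> x = a \<odot>\<^bsub>M\<^esub> x \<oplus>\<^bsub>M\<^esub> b \<odot>\<^bsub>M\<^esub> x"
    and smult_r_distr:
      "\<lbrakk>a \<in> carrier R; x \<in> carrier M; y \<in> carrier M\<rbrakk> \<Longrightarrow>
       a \<odot>\<^bsub>M\<^esub> (x \<oplus>\<^bsub>M\<^esub> y) = a \<odot>\<^bsub>M\<^esub> x \<oplus>\<^bsub>M\<^esub> a \<odot>\<^bsub>M\<^esub> y"
    and smult_assoc1:
      "\<lbrakk>a \<in> carrier R; b \<in> carrier R; x \<in> carrier M\<rbrakk> \<Longrightarrow>
       (a \<otimes> b) \<odot>\<^bsub>M\<^esub> x = a \<odot>\<^bsub>M\<^esub> (b \<odot>\<^bsub>M\<^esub> x)"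
    and smult_one [simp]: "x \<in> carrier M \<Longrightarrow> \<one> \<odot>\<^bsub>M\<^esub> x = x"

text \<open>
  Scalar multiplication on cosets is \<open>a(P + x) = P + ax\<close>, written as a union over all
  representatives \<open>x\<close>. The fields \<open>mult\<close> and \<open>one\<close> are irrelevant for modules.
\<close>

definition quotient_module :: "('a, 'b, 'm) module_scheme \<Rightarrow> 'b set \<Rightarrow> ('a, 'b set) module" where
  "quotient_module M P =
    \<lparr>carrier = a_rcosets\<^bsub>M\<^esub> P, mult = undefined, one = undefined,
     zero = P, add = set_add M,
     smult = (\<lambda>a X. \<Union>x\<in>X. P +>\<^bsub>M\<^esub> (a \<odot>\<^bsub>M\<^esub> x))\<rparr>"

definition module_Hom ::
  "('a, 'r) ring_scheme \<Rightarrow> ('a, 'b, 'm) module_scheme \<Rightarrow> ('a, 'c, 'n) module_scheme \<Rightarrow> ('b \<Rightarrow> 'c) set"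
where
  "module_Hom R M N =
    {f \<in> carrier M \<rightarrow>\<^sub>E carrier N.
      (\<forall>x\<in>carrier M. \<forall>y\<in>carrier M. f (x \<oplus>\<^bsub>M\<^esub> y) = f x \<oplus>\<^bsub>N\<^esub> f y) \<and>
      (\<forall>a\<in>carrier R. \<forall>x\<in>carrier M. f (a \<odot>\<^bsub>M\<^esub> x) = a \<odot>\<^bsub>N\<^esub> f x)}"

definition zero_hom :: "('a, 'b, 'm) module_scheme \<Rightarrow> ('a, 'c, 'n) module_scheme \<Rightarrow> 'b \<Rightarrow> 'c" where
  "zero_hom M N = (\<lambda>x\<in>carrier M. \<zero>\<^bsub>N\<^esub>)"

definition simple_module :: "('a, 'r) ring_scheme \<Rightarrow> ('a, 'b, 'm) module_scheme \<Rightarrow> bool" where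
  "simple_module R M \<longleftrightarrow>
    left_module R M \<and> carrier M \<noteq> {\<zero>\<^bsub>M\<^esub>} \<and>
    (\<forall>N. submodule N R M \<longrightarrow> N = {\<zero>\<^bsub>M\<^esub>} \<or> N = carrier M)"

text \<open>The sum of a family of submodules, i.e. the smallest submodule containing all of them.\<close>

definition submodule_sum ::
  "('a, 'r) ring_scheme \<Rightarrow> ('a, 'b, 'm) module_scheme \<Rightarrow> 'b set set \<Rightarrow> 'b set"
where
  "submodule_sum R M \<S> = \<Inter>{N. submodule N R M \<and> \<Union>\<S> \<subseteq> N}"

text \<open>A module is semisimple if it is the sum of its simple submodules; the zero module is included.\<close>

definition semisimple_module :: "('a, 'r) ring_scheme \<Rightarrow> ('a, 'b, 'm) module_scheme \<Rightarrow> bool" where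
  "semisimple_module R M \<longleftrightarrow>
    left_module R M \<and>
    submodule_sum R M {S. submodule S R M \<and> simple_module R (M\<lparr>carrier := S\<rparr>)} = carrier M"

definition completely_prime_module ::
  "('a, 'r) ring_scheme \<Rightarrow> ('a, 'b, 'm) module_scheme \<Rightarrow> bool"
where
  "completely_prime_module R M \<longleftrightarrow>
    left_module R M \<and>
    {a \<odot>\<^bsub>M\<^esub> m | a m. a \<in> carrier R \<and> m \<in> carrier M} \<noteq> {\<zero>\<^bsub>M\<^esub>} \<and>
    (\<forall>a\<in>carrier R. \<forall>m\<in>carrier M. a \<odot>\<^bsub>M\<^esub> m = \<zero>\<^bsub>M\<^esub> \<longrightarrow>
      m = \<zero>\<^bsub>M\<^esub> \<or> {a \<odot>\<^bsub>M\<^esub> x | x. x \<in> carrier M} = {\<zero>\<^bsub>M\<^esub>})"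

definition completely_prime_submodule ::
  "'b set \<Rightarrow> ('a, 'r) ring_scheme \<Rightarrow> ('a, 'b, 'm) module_scheme \<Rightarrow> bool"
where
  "completely_prime_submodule P R M \<longleftrightarrow>
    submodule P R M \<and> completely_prime_module R (quotient_module M P)"

definition cp_radical :: "('a, 'r) ring_scheme \<Rightarrow> ('a, 'b, 'm) module_scheme \<Rightarrow> 'b set" where
  "cp_radical R M =
    (if \<exists>P. completely_prime_submodule P R M
     then \<Inter>{P. completely_prime_submodule P R M}
     else carrier M)"

text \<open>
  Classes of modules are sets of module records over one carrier type \<open>'b\<close>, which plays the role of
  the universe and is left arbitrary.
\<close>

definition torsion_theory ::
  "('a, 'r) ring_scheme \<Rightarrow> ('a, 'b) module set \<Rightarrow> ('a, 'b) module set \<Rightarrow> ('a, 'b) module set \<Rightarrow> bool"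
where
  "torsion_theory R \<C> \<T> \<F> \<longleftrightarrow>
    \<T> \<subseteq> \<C> \<and> \<F> \<subseteq> \<C> \<and>
    (\<forall>T\<in>\<T>. \<forall>F\<in>\<F>. module_Hom R T F = {zero_hom T F}) \<and>
    (\<forall>C\<in>\<C>. (\<forall>F\<in>\<F>. module_Hom R C F = {zero_hom C F}) \<longrightarrow> C \<in> \<T>) \<and>
    (\<forall>C\<in>\<C>. (\<forall>T\<in>\<T>. module_Hom R T C = {zero_hom T C}) \<longrightarrow> C \<in> \<F>)"

end

theory Submission
  imports Defs
begin

text \<open>
  Everything rests on the fact that submodules of a semisimple module are direct summands. If \<open>P\<close> is
  completely prime in \<open>N \<subseteq> M\<close>, there is \<open>Q\<close> with \<open>Q \<inter> N = P\<close> and \<open>Q + N = M\<close>, so \<open>M/Q \<cong> N/P\<close> and \<open>Q\<close>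
  is completely prime in \<open>M\<close>; conversely completely prime submodules of \<open>M\<close> pull back along any
  homomorphism into \<open>M\<close> to completely prime submodules or to everything. This makes the radical
  hereditary, hence idempotent. For the torsion theory, a complement \<open>K\<close> of \<open>\<beta>(M)\<close> replaces \<open>M/\<beta>(M)\<close>:
  it lives on the same carrier type and satisfies \<open>\<beta>(K) = K \<inter> \<beta>(M) = 0\<close>, so the projection
  \<open>M \<rightarrow> K\<close> detects whether \<open>M\<close> is torsion, just as the inclusion \<open>\<beta>(M) \<rightarrow> M\<close> detects whether it is
  torsion-free.
\<close>

text \<open>Complete primeness is defined by comparing sets of products with
  \<open>{\<zero>}\<close>. This lemma and the next turn such comparisons into pointwise statements;
  nonemptiness rules out an empty set of products.\<close>

lemma image_singleton_iff:
  assumes "X \<noteq> {}"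
  shows "{f x | x. x \<in> X} = {c} \<longleftrightarrow> (\<forall>x\<in>X. f x = c)"
  using assms by auto

lemma image2_singleton_iff:
  assumes "A \<noteq> {}" and "X \<noteq> {}"
  shows "{f a x | a x. a \<in> A \<and> x \<in> X} = {c} \<longleftrightarrow> (\<forall>a\<in>A. \<forall>x\<in>X. f a x = c)"
  using assms by auto metis

section \<open>Arithmetic of left modules and their submodules\<close>

context left_module
begin

lemma smult_l_zero [simp]:
  assumes "x \<in> carrier M"
  shows "\<zero> \<odot>\<^bsub>M\<^esub> x = \<zero>\<^bsub>M\<^esub>"
  by (metis M.add.r_cancel_one' R.l_zero R.zero_closed assms smult_closed smult_l_distr)

lemma smult_r_zero [simp]:
  assumes "a \<in> carrier R"
  shows "a \<odot>\<^bsub>M\<^esub> \<zero>\<^bsub>M\<^esub> = \<zero>\<^bsub>M\<^esub>"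
  by (metis M.add.r_cancel_one' M.l_zero M.zero_closed assms smult_closed smult_r_distr)

lemma smult_minus_one:
  assumes "x \<in> carrier M"
  shows "(\<ominus> \<one>) \<odot>\<^bsub>M\<^esub> x = \<ominus>\<^bsub>M\<^esub> x"
proof -
  have "(\<ominus> \<one>) \<odot>\<^bsub>M\<^esub> x \<oplus>\<^bsub>M\<^esub> x = (\<ominus> \<one> \<oplus> \<one>) \<odot>\<^bsub>M\<^esub> x"
    using assms by (simp add: smult_l_distr)
  also have "\<dots> = \<zero>\<^bsub>M\<^esub>"
    using assms by (simp add: R.l_neg)
  finally show ?thesis
    using assms by (metis M.minus_equality R.a_inv_closed R.one_closed smult_closed)
qed

text \<open>Negation is the action of \<open>\<ominus> \<one>\<close>, so closure under scalars
  yields closure under negation. This is the working form of \<open>submodule\<close> from here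
  on.\<close>

lemma submodule_iff:
  "submodule H R M \<longleftrightarrow>
    H \<subseteq> carrier M \<and> \<zero>\<^bsub>M\<^esub> \<in> H \<and> (\<forall>x\<in>H. \<forall>y\<in>H. x \<oplus>\<^bsub>M\<^esub> y \<in> H) \<and>
    (\<forall>a\<in>carrier R. \<forall>x\<in>H. a \<odot>\<^bsub>M\<^esub> x \<in> H)" (is "_ \<longleftrightarrow> ?Q")
proof
  assume "submodule H R M"
  then interpret submodule H R M .
  show ?Q
    using subset m_closed one_closed by auto
next
  assume Q: ?Q
  then have "\<ominus>\<^bsub>M\<^esub> x \<in> H" if "x \<in> H" for x
    using that smult_minus_one by (metis R.a_inv_closed R.one_closed subsetD)
  with Q show "submodule H R M"
    by (intro submodule.intro subgroup.intro submodule_axioms.intro) (auto simp: a_inv_def)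
qed

lemma submodule_minus:
  assumes "submodule H R M" and "x \<in> H"
  shows "\<ominus>\<^bsub>M\<^esub> x \<in> H"
  using assms smult_minus_one unfolding submodule_iff
  by (metis R.a_inv_closed R.one_closed subsetD)

lemma submodule_add_cancel:
  assumes "submodule H R M" and "x \<in> H" and "y \<in> carrier M"
  shows "x \<oplus>\<^bsub>M\<^esub> y \<in> H \<longleftrightarrow> y \<in> H"
proof
  assume "x \<oplus>\<^bsub>M\<^esub> y \<in> H"
  then have "\<ominus>\<^bsub>M\<^esub> x \<oplus>\<^bsub>M\<^esub> (x \<oplus>\<^bsub>M\<^esub> y) \<in> H"
    using assms submodule_minus by (simp add: submodule_iff)
  moreover have "x \<in> carrier M"
    using assms by (auto simp: submodule_iff)
  ultimately show "y \<in> H"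
    using assms(3) by (simp add: M.r_neg1)
qed (use assms in \<open>auto simp: submodule_iff\<close>)

lemma left_module_submodule:
  assumes "submodule N R M"
  shows "left_module R (M\<lparr>carrier := N\<rparr>)"
proof -
  have sub: "N \<subseteq> carrier M" "\<zero>\<^bsub>M\<^esub> \<in> N" "\<And>x y. x \<in> N \<Longrightarrow> y \<in> N \<Longrightarrow> x \<oplus>\<^bsub>M\<^esub> y \<in> N"
    "\<And>a x. a \<in> carrier R \<Longrightarrow> x \<in> N \<Longrightarrow> a \<odot>\<^bsub>M\<^esub> x \<in> N"
    using assms by (auto simp: submodule_iff)
  have "abelian_group (M\<lparr>carrier := N\<rparr>)"
  proof (rule abelian_groupI)
    fix x assume "x \<in> carrier (M\<lparr>carrier := N\<rparr>)"
    then show "\<exists>y\<in>carrier (M\<lparr>carrier := N\<rparr>).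
        y \<oplus>\<^bsub>M\<lparr>carrier := N\<rparr>\<^esub> x = \<zero>\<^bsub>M\<lparr>carrier := N\<rparr>\<^esub>"
      using submodule_minus[OF assms] sub(1) by (intro bexI[of _ "\<ominus>\<^bsub>M\<^esub> x"]) (auto simp: M.l_neg)
  qed (use sub in \<open>auto simp: M.a_ac subsetD\<close>)
  then show ?thesis
    using sub R.ring_axioms
    by (intro left_module.intro left_module_axioms.intro)
      (auto simp: smult_l_distr smult_r_distr smult_assoc1 subsetD)
qed

lemma submodule_submodule_iff:
  assumes "submodule N R M"
  shows "submodule K R (M\<lparr>carrier := N\<rparr>) \<longleftrightarrow> submodule K R M \<and> K \<subseteq> N"
proof -
  interpret N: left_module R "M\<lparr>carrier := N\<rparr>"
    using assms by (rule left_module_submodule)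
  show ?thesis
    using assms unfolding submodule_iff N.submodule_iff by auto
qed

lemma carrier_submodule: "submodule (carrier M) R M"
  by (simp add: submodule_iff)

lemma zero_submodule: "submodule {\<zero>\<^bsub>M\<^esub>} R M"
  by (simp add: submodule_iff)

lemma submodule_Int:
  assumes "submodule H R M" and "submodule K R M"
  shows "submodule (H \<inter> K) R M"
  using assms by (auto simp: submodule_iff)

lemma submodule_Inter:
  assumes "\<S> \<noteq> {}" and "\<And>H. H \<in> \<S> \<Longrightarrow> submodule H R M"
  shows "submodule (\<Inter>\<S>) R M"
  using assms unfolding submodule_iff by blast

lemma mem_set_add_iff:
  "x \<in> H <+>\<^bsub>M\<^esub> K \<longleftrightarrow> (\<exists>h\<in>H. \<exists>k\<in>K. x = h \<oplus>\<^bsub>M\<^esub> k)"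
  by (auto simp: set_add_def' )

lemma submodule_set_add:
  assumes H: "submodule H R M" and K: "submodule K R M"
  shows "submodule (H <+>\<^bsub>M\<^esub> K) R M"
  unfolding submodule_iff
proof (intro conjI ballI)
  have sub: "H \<subseteq> carrier M" "K \<subseteq> carrier M"
    using assms by (auto simp: submodule_iff)
  then show "H <+>\<^bsub>M\<^esub> K \<subseteq> carrier M"
    by (rule M.setadd_subset_G)
  show "\<zero>\<^bsub>M\<^esub> \<in> H <+>\<^bsub>M\<^esub> K"
    using assms unfolding mem_set_add_iff submodule_iff by (metis M.l_zero M.zero_closed)
  fix x assume x: "x \<in> H <+>\<^bsub>M\<^esub> K"
  then obtain h k where hk: "h \<in> H" "k \<in> K" "x = h \<oplus>\<^bsub>M\<^esub> k"
    by (auto simp: mem_set_add_iff)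
  show "x \<oplus>\<^bsub>M\<^esub> y \<in> H <+>\<^bsub>M\<^esub> K" if y: "y \<in> H <+>\<^bsub>M\<^esub> K" for y
  proof -
    obtain h' k' where hk': "h' \<in> H" "k' \<in> K" "y = h' \<oplus>\<^bsub>M\<^esub> k'"
      using y by (auto simp: mem_set_add_iff)
    have "x \<oplus>\<^bsub>M\<^esub> y = (h \<oplus>\<^bsub>M\<^esub> h') \<oplus>\<^bsub>M\<^esub> (k \<oplus>\<^bsub>M\<^esub> k')"
      using hk hk' sub by (auto simp: M.a_ac subsetD)
    then show ?thesis
      using hk hk' assms unfolding mem_set_add_iff submodule_iff by blast
  qed
  show "a \<odot>\<^bsub>M\<^esub> x \<in> H <+>\<^bsub>M\<^esub> K" if "a \<in> carrier R" for a
  proof -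
    have "a \<odot>\<^bsub>M\<^esub> x = a \<odot>\<^bsub>M\<^esub> h \<oplus>\<^bsub>M\<^esub> a \<odot>\<^bsub>M\<^esub> k"
      using hk sub that by (auto simp: smult_r_distr subsetD)
    then show ?thesis
      using that hk assms unfolding mem_set_add_iff submodule_iff by blast
  qed
qed

lemma subset_set_add:
  assumes "submodule H R M" and "submodule K R M"
  shows "H \<subseteq> H <+>\<^bsub>M\<^esub> K" and "K \<subseteq> H <+>\<^bsub>M\<^esub> K"
proof -
  show "H \<subseteq> H <+>\<^bsub>M\<^esub> K"
    using assms unfolding submodule_iff subset_iff mem_set_add_iff by (metis M.r_zero)
  show "K \<subseteq> H <+>\<^bsub>M\<^esub> K"
    using assms unfolding submodule_iff subset_iff mem_set_add_iff by (metis M.l_zero)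
qed

section \<open>Quotient modules and complete primeness\<close>

lemma abelian_subgroup_submodule:
  assumes "submodule P R M"
  shows "abelian_subgroup P M"
  using assms by (intro abelian_subgroupI3 additive_subgroupI)
    (auto simp: submodule_def M.abelian_group_axioms)

text \<open>The union in \<open>quotient_module\<close> runs over all representatives
  \<open>y\<close> of the coset. Since \<open>y\<close> differs from \<open>x\<close> by some
  \<open>p\<close> in \<open>P\<close>, the multiples differ by \<open>a p\<close>, again in
  \<open>P\<close>, so all cosets in the union coincide.\<close>

lemma quotient_smult:
  assumes P: "submodule P R M" and a: "a \<in> carrier R" and x: "x \<in> carrier M"
  shows "a \<odot>\<^bsub>quotient_module M P\<^esub> (P +>\<^bsub>M\<^esub> x) = P +>\<^bsub>M\<^esub> (a \<odot>\<^bsub>M\<^esub> x)"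
proof -
  interpret P: abelian_subgroup P M
    using P by (rule abelian_subgroup_submodule)
  have "P +>\<^bsub>M\<^esub> (a \<odot>\<^bsub>M\<^esub> y) = P +>\<^bsub>M\<^esub> (a \<odot>\<^bsub>M\<^esub> x)" if "y \<in> P +>\<^bsub>M\<^esub> x" for y
  proof -
    obtain p where p: "p \<in> P" "y = p \<oplus>\<^bsub>M\<^esub> x"
      using \<open>y \<in> P +>\<^bsub>M\<^esub> x\<close> by (auto simp: a_r_coset_def')
    then have "a \<odot>\<^bsub>M\<^esub> y = a \<odot>\<^bsub>M\<^esub> p \<oplus>\<^bsub>M\<^esub> a \<odot>\<^bsub>M\<^esub> x"
      using a x by (simp add: smult_r_distr)
    moreover have "a \<odot>\<^bsub>M\<^esub> p \<in> P"
      using P p a by (auto simp: submodule_iff)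
    ultimately have "a \<odot>\<^bsub>M\<^esub> y \<in> P +>\<^bsub>M\<^esub> (a \<odot>\<^bsub>M\<^esub> x)"
      by (auto simp: a_r_coset_def')
    then show ?thesis
      using M.a_repr_independence[OF _ _ P.a_subgroup] a x by auto
  qed
  moreover have "P +>\<^bsub>M\<^esub> x \<noteq> {}"
    using P.a_rcos_self[OF x] by blast
  ultimately show ?thesis
    unfolding quotient_module_def by auto
qed

lemma quotient_coset_cases:
  assumes "X \<in> carrier (quotient_module M P)"
  obtains x where "x \<in> carrier M" and "X = P +>\<^bsub>M\<^esub> x"
  using assms by (auto simp: quotient_module_def A_RCOSETS_def')

lemma coset_eq_iff:
  assumes "submodule P R M" and "x \<in> carrier M"
  shows "P +>\<^bsub>M\<^esub> x = P \<longleftrightarrow> x \<in> P"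
proof -
  interpret P: abelian_subgroup P M
    using assms(1) by (rule abelian_subgroup_submodule)
  show ?thesis
    using P.a_rcos_self M.a_coset_join2 P.a_subgroup assms(2) by blast
qed

lemma left_module_quotient:
  assumes P: "submodule P R M"
  shows "left_module R (quotient_module M P)"
proof -
  interpret P: abelian_subgroup P M
    using P by (rule abelian_subgroup_submodule)
  let ?Q = "quotient_module M P"
  have coset: "P +>\<^bsub>M\<^esub> x \<in> carrier ?Q" if "x \<in> carrier M" for x
    using that P.a_subset by (simp add: quotient_module_def M.a_rcosetsI)
  have add: "(P +>\<^bsub>M\<^esub> x) \<oplus>\<^bsub>?Q\<^esub> (P +>\<^bsub>M\<^esub> y) = P +>\<^bsub>M\<^esub> (x \<oplus>\<^bsub>M\<^esub> y)"
    if "x \<in> carrier M" "y \<in> carrier M" for x y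
    using that by (simp add: quotient_module_def P.a_rcos_sum)
  \<comment> \<open>Writing zero as a coset reduces the group axioms to equations between
    representatives. The simp rule \<open>M.a_coset_add_zero\<close> would undo this and is
    therefore deleted there.\<close>
  have zero: "\<zero>\<^bsub>?Q\<^esub> = P +>\<^bsub>M\<^esub> \<zero>\<^bsub>M\<^esub>"
    using P.a_subset by (simp add: quotient_module_def)
  note smult = quotient_smult[OF P]
  have "abelian_group ?Q"
  proof (rule abelian_groupI)
    fix X assume "X \<in> carrier ?Q"
    then obtain x where x: "x \<in> carrier M" "X = P +>\<^bsub>M\<^esub> x"
      by (rule quotient_coset_cases)
    then have "(P +>\<^bsub>M\<^esub> (\<ominus>\<^bsub>M\<^esub> x)) \<oplus>\<^bsub>?Q\<^esub> X = \<zero>\<^bsub>?Q\<^esub>"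
      by (simp add: add zero M.l_neg del: M.a_coset_add_zero)
    then show "\<exists>Y\<in>carrier ?Q. Y \<oplus>\<^bsub>?Q\<^esub> X = \<zero>\<^bsub>?Q\<^esub>"
      using coset x(1) by blast
  qed (auto elim!: quotient_coset_cases
         simp: add zero coset M.a_ac simp del: M.a_coset_add_zero)
  then show ?thesis
    using R.ring_axioms
    by (intro left_module.intro left_module_axioms.intro)
      (auto elim!: quotient_coset_cases
         simp: add smult coset smult_l_distr smult_r_distr smult_assoc1)
qed

text \<open>Vanishing in \<open>M/P\<close> is membership in \<open>P\<close>, which removes all
  cosets from the definition. Later arguments about complete primeness use this elementwise
  form.\<close>

lemma completely_prime_submodule_iff:
  "completely_prime_submodule P R M \<longleftrightarrow>
    submodule P R M \<and> P \<noteq> carrier M \<and>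
    (\<forall>a\<in>carrier R. \<forall>m\<in>carrier M. a \<odot>\<^bsub>M\<^esub> m \<in> P \<longrightarrow>
      m \<in> P \<or> (\<forall>x\<in>carrier M. a \<odot>\<^bsub>M\<^esub> x \<in> P))"
proof (cases "submodule P R M")
  case True
  let ?Q = "quotient_module M P"
  have sub: "P \<subseteq> carrier M"
    using True by (simp add: submodule_iff)
  have car: "carrier ?Q = (\<lambda>x. P +>\<^bsub>M\<^esub> x) ` carrier M"
    by (auto simp: quotient_module_def A_RCOSETS_def')
  have zero: "\<zero>\<^bsub>?Q\<^esub> = P"
    by (simp add: quotient_module_def)
  have smult0: "a \<odot>\<^bsub>?Q\<^esub> (P +>\<^bsub>M\<^esub> x) = P \<longleftrightarrow> a \<odot>\<^bsub>M\<^esub> x \<in> P"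
    if "a \<in> carrier R" "x \<in> carrier M" for a x
    using that True by (simp add: quotient_smult coset_eq_iff)
  have ne: "carrier R \<noteq> {}" "carrier ?Q \<noteq> {}"
    unfolding car using R.one_closed M.zero_closed by blast+
  have "{a \<odot>\<^bsub>?Q\<^esub> m | a m. a \<in> carrier R \<and> m \<in> carrier ?Q} = {P} \<longleftrightarrow>
      (\<forall>a\<in>carrier R. \<forall>x\<in>carrier M. a \<odot>\<^bsub>?Q\<^esub> (P +>\<^bsub>M\<^esub> x) = P)"
    by (subst image2_singleton_iff[OF ne]) (simp add: car)
  also have "\<dots> \<longleftrightarrow> (\<forall>a\<in>carrier R. \<forall>x\<in>carrier M. a \<odot>\<^bsub>M\<^esub> x \<in> P)"
    using smult0 by simp
  \<comment> \<open>Unitality enters here: taking \<open>a = \<one>\<close> puts every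
    \<open>x\<close> into \<open>P\<close>.\<close>
  also have "\<dots> \<longleftrightarrow> P = carrier M"
    using sub smult_one R.one_closed by (metis smult_closed subsetI subset_antisym)
  finally have 1: "{a \<odot>\<^bsub>?Q\<^esub> m | a m. a \<in> carrier R \<and> m \<in> carrier ?Q} = {P} \<longleftrightarrow> P = carrier M" .
  have 2: "{a \<odot>\<^bsub>?Q\<^esub> X | X. X \<in> carrier ?Q} = {P} \<longleftrightarrow> (\<forall>x\<in>carrier M. a \<odot>\<^bsub>M\<^esub> x \<in> P)"
    if a: "a \<in> carrier R" for a
    using smult0 a by (subst image_singleton_iff[OF ne(2)]) (simp add: car)
  have "(\<forall>X\<in>carrier ?Q. a \<odot>\<^bsub>?Q\<^esub> X = P \<longrightarrow> X = P \<or>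
        {a \<odot>\<^bsub>?Q\<^esub> X | X. X \<in> carrier ?Q} = {P}) \<longleftrightarrow>
      (\<forall>m\<in>carrier M. a \<odot>\<^bsub>M\<^esub> m \<in> P \<longrightarrow>
        m \<in> P \<or> (\<forall>x\<in>carrier M. a \<odot>\<^bsub>M\<^esub> x \<in> P))" if "a \<in> carrier R" for a
    unfolding 2[OF that] by (simp add: car that smult0 coset_eq_iff[OF True])
  then show ?thesis
    unfolding completely_prime_submodule_def completely_prime_module_def zero 1
    using True left_module_quotient[OF True] by simp
qed (simp add: completely_prime_submodule_def)

section \<open>Simple submodules and complements in semisimple modules\<close>

lemma simple_submodule_iff:
  assumes "submodule S R M"
  shows "simple_module R (M\<lparr>carrier := S\<rparr>) \<longleftrightarrow>
    S \<noteq> {\<zero>\<^bsub>M\<^esub>} \<and> (\<forall>N. submodule N R M \<and> N \<subseteq> S \<longrightarrow> N = {\<zero>\<^bsub>M\<^esub>} \<or> N = S)"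
  using assms
  by (simp add: simple_module_def left_module_submodule submodule_submodule_iff)

text \<open>An induction principle: \<open>submodule_sum\<close> is an intersection of submodules,
  and \<open>U\<close> is one of those intersected.\<close>

lemma semisimple_submodule_eq_carrier:
  assumes "semisimple_module R M" and "submodule U R M"
    and "\<And>S. submodule S R M \<Longrightarrow> simple_module R (M\<lparr>carrier := S\<rparr>) \<Longrightarrow> S \<subseteq> U"
  shows "U = carrier M"
proof
  show "U \<subseteq> carrier M"
    using assms(2) by (simp add: submodule_iff)
  have "carrier M = submodule_sum R M {S. submodule S R M \<and> simple_module R (M\<lparr>carrier := S\<rparr>)}"
    using assms(1) by (simp add: semisimple_module_def)
  also have "\<dots> \<subseteq> U"
    unfolding submodule_sum_def using assms(2,3) by blast
  finally show "carrier M \<subseteq> U" .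
qed

text \<open>For \<open>P = {\<zero>}\<close> this says that \<open>N\<close> is a direct summand; in general, \<open>M/Q \<cong> N/P\<close>.\<close>

lemma semisimple_extend_submodule:
  assumes ss: "semisimple_module R M"
    and N: "submodule N R M" and P: "submodule P R M" and PN: "P \<subseteq> N"
  obtains Q where "submodule Q R M" and "Q \<inter> N = P" and "Q <+>\<^bsub>M\<^esub> N = carrier M"
proof -
  let ?A = "{Q. submodule Q R M \<and> Q \<inter> N = P}"
  \<comment> \<open>Zorn's lemma provides \<open>Q\<close> maximal among the submodules meeting
    \<open>N\<close> exactly in \<open>P\<close>; maximality will force the sum with
    \<open>N\<close> to be everything.\<close>
  have "\<exists>Q\<in>?A. \<forall>X\<in>?A. Q \<subseteq> X \<longrightarrow> X = Q"
  proof (rule subset_Zorn_nonempty)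
    show "?A \<noteq> {}"
      using P PN by blast
    fix \<C> assume ne: "\<C> \<noteq> {}" and chain: "subset.chain ?A \<C>"
    then have mem: "\<And>H. H \<in> \<C> \<Longrightarrow> submodule H R M" "\<And>H. H \<in> \<C> \<Longrightarrow> H \<inter> N = P"
      and tot: "\<And>H K. H \<in> \<C> \<Longrightarrow> K \<in> \<C> \<Longrightarrow> H \<subseteq> K \<or> K \<subseteq> H"
      by (auto simp: subset_chain_def)
    have "x \<oplus>\<^bsub>M\<^esub> y \<in> \<Union>\<C>" if "x \<in> \<Union>\<C>" "y \<in> \<Union>\<C>" for x y
    proof -
      from that obtain H K where HK: "H \<in> \<C>" "x \<in> H" "K \<in> \<C>" "y \<in> K"
        by blast
      then obtain L where "L \<in> \<C>" "x \<in> L" "y \<in> L"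
        using tot by blast
      then show ?thesis
        using mem(1) unfolding submodule_iff by blast
    qed
    moreover have "\<Union>\<C> \<subseteq> carrier M" "\<zero>\<^bsub>M\<^esub> \<in> \<Union>\<C>"
      "\<forall>a\<in>carrier R. \<forall>x\<in>\<Union>\<C>. a \<odot>\<^bsub>M\<^esub> x \<in> \<Union>\<C>"
      using ne mem(1) unfolding submodule_iff by blast+
    ultimately have "submodule (\<Union>\<C>) R M"
      unfolding submodule_iff by blast
    moreover have "\<Union>\<C> \<inter> N = P"
      using ne mem(2) by blast
    ultimately show "\<Union>\<C> \<in> ?A"
      by blast
  qed
  then obtain Q where Q: "submodule Q R M" "Q \<inter> N = P"
    and max: "\<And>X. submodule X R M \<Longrightarrow> X \<inter> N = P \<Longrightarrow> Q \<subseteq> X \<Longrightarrow> X = Q"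
    by blast
  have QN: "submodule (Q <+>\<^bsub>M\<^esub> N) R M"
    using Q(1) N by (rule submodule_set_add)
  have "Q <+>\<^bsub>M\<^esub> N = carrier M"
  proof (rule semisimple_submodule_eq_carrier[OF ss QN])
    fix S assume S: "submodule S R M" and simple: "simple_module R (M\<lparr>carrier := S\<rparr>)"
    show "S \<subseteq> Q <+>\<^bsub>M\<^esub> N"
    proof (rule ccontr)
      assume "\<not> S \<subseteq> Q <+>\<^bsub>M\<^esub> N"
      moreover have "submodule ((Q <+>\<^bsub>M\<^esub> N) \<inter> S) R M"
        using QN S by (rule submodule_Int)
      \<comment> \<open>A simple \<open>S\<close> outside \<open>Q + N\<close> meets it in a proper
        submodule of \<open>S\<close>, hence trivially.\<close>
      ultimately have disj: "(Q <+>\<^bsub>M\<^esub> N) \<inter> S = {\<zero>\<^bsub>M\<^esub>}"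
        using simple unfolding simple_submodule_iff[OF S] by (metis inf.cobounded1 inf.cobounded2)
      \<comment> \<open>If \<open>q + s\<close> lies in \<open>N\<close>, then \<open>s\<close> lies
        in \<open>Q + N\<close> and is zero by \<open>disj\<close>. So \<open>Q + S\<close> competes
        with \<open>Q\<close>, and maximality puts \<open>S\<close> inside \<open>Q\<close>, a
        contradiction.\<close>
      have "(Q <+>\<^bsub>M\<^esub> S) \<inter> N = P"
      proof
        show "P \<subseteq> (Q <+>\<^bsub>M\<^esub> S) \<inter> N"
          using Q S subset_set_add(1) by blast
        show "(Q <+>\<^bsub>M\<^esub> S) \<inter> N \<subseteq> P"
        proof
          fix x assume x: "x \<in> (Q <+>\<^bsub>M\<^esub> S) \<inter> N"
          then obtain q s where qs: "q \<in> Q" "s \<in> S" "x = q \<oplus>\<^bsub>M\<^esub> s"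
            by (auto simp: mem_set_add_iff)
          have "q \<in> Q <+>\<^bsub>M\<^esub> N" "x \<in> Q <+>\<^bsub>M\<^esub> N"
            using subset_set_add[OF Q(1) N] qs x by auto
          then have "s \<in> Q <+>\<^bsub>M\<^esub> N"
            using submodule_add_cancel[OF QN] qs S by (auto simp: submodule_iff)
          then have "s = \<zero>\<^bsub>M\<^esub>"
            using disj qs by blast
          then have "x = q"
            using qs Q(1) by (auto simp: submodule_iff)
          then show "x \<in> P"
            using x qs Q(2) by blast
        qed
      qed
      then have "Q <+>\<^bsub>M\<^esub> S = Q"
        using max submodule_set_add subset_set_add(1) Q(1) S by blast
      then have "S \<subseteq> Q <+>\<^bsub>M\<^esub> N"
        using subset_set_add[OF Q(1) S] subset_set_add[OF Q(1) N] by blast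
      then show False
        using \<open>\<not> S \<subseteq> Q <+>\<^bsub>M\<^esub> N\<close> by contradiction
    qed
  qed
  then show thesis
    using that Q by blast
qed

section \<open>The radical as a submodule\<close>

text \<open>Intersecting with \<open>carrier M\<close> absorbs the case distinction: an empty family
  has intersection \<open>UNIV\<close>, and otherwise each member already lies in
  \<open>carrier M\<close>.\<close>

lemma cp_radical_eq:
  "cp_radical R M = carrier M \<inter> \<Inter>{P. completely_prime_submodule P R M}"
proof -
  have "P \<subseteq> carrier M" if "completely_prime_submodule P R M" for P
    using that by (simp add: completely_prime_submodule_iff submodule_iff)
  then show ?thesis
    unfolding cp_radical_def by (simp split: if_splits) blast
qed

lemma submodule_cp_radical: "submodule (cp_radical R M) R M"
proof -
  have "cp_radical R M = \<Inter>(insert (carrier M) {P. completely_prime_submodule P R M})"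
    by (simp add: cp_radical_eq)
  also have "submodule \<dots> R M"
    by (rule submodule_Inter) (auto simp: carrier_submodule completely_prime_submodule_def)
  finally show ?thesis .
qed

section \<open>Inclusions and projections of direct summands\<close>

lemma module_Hom_inclusion:
  assumes "submodule N R M"
  shows "(\<lambda>x\<in>N. x) \<in> module_Hom R (M\<lparr>carrier := N\<rparr>) M"
  using assms by (auto simp: module_Hom_def submodule_iff)

lemma projection_exists:
  assumes N: "submodule N R M" and K: "submodule K R M"
    and disj: "N \<inter> K = {\<zero>\<^bsub>M\<^esub>}" and sum: "N <+>\<^bsub>M\<^esub> K = carrier M"
  obtains f where "f \<in> module_Hom R M (M\<lparr>carrier := K\<rparr>)" and "\<And>k. k \<in> K \<Longrightarrow> f k = k"
proof -
  have sub: "N \<subseteq> carrier M" "K \<subseteq> carrier M"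
    using N K by (auto simp: submodule_iff)
  \<comment> \<open>The difference of \<open>k\<close> and \<open>k'\<close> is also a difference of
    elements of \<open>N\<close>, so it lies in \<open>N \<inter> K\<close> and vanishes.\<close>
  have unique: "k = k'"
    if nk: "n \<in> N" "k \<in> K" "n' \<in> N" "k' \<in> K" and eq: "n \<oplus>\<^bsub>M\<^esub> k = n' \<oplus>\<^bsub>M\<^esub> k'" for n k n' k'
  proof -
    have car: "n \<in> carrier M" "k \<in> carrier M" "n' \<in> carrier M" "k' \<in> carrier M"
      using nk sub by auto
    have "n \<oplus>\<^bsub>M\<^esub> (k \<oplus>\<^bsub>M\<^esub> \<ominus>\<^bsub>M\<^esub> k') = (n' \<oplus>\<^bsub>M\<^esub> k') \<oplus>\<^bsub>M\<^esub> \<ominus>\<^bsub>M\<^esub> k'"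
      using car by (simp add: M.a_assoc flip: eq)
    also have "\<dots> = n'"
      using car by (simp add: M.a_assoc M.r_neg)
    finally have "n \<oplus>\<^bsub>M\<^esub> (k \<oplus>\<^bsub>M\<^esub> \<ominus>\<^bsub>M\<^esub> k') \<in> N"
      using nk by simp
    then have "k \<oplus>\<^bsub>M\<^esub> \<ominus>\<^bsub>M\<^esub> k' \<in> N"
      using submodule_add_cancel[OF N] nk car by simp
    moreover have "k \<oplus>\<^bsub>M\<^esub> \<ominus>\<^bsub>M\<^esub> k' \<in> K"
      using K nk submodule_minus[OF K] by (simp add: submodule_iff)
    ultimately have "k \<oplus>\<^bsub>M\<^esub> \<ominus>\<^bsub>M\<^esub> k' = \<zero>\<^bsub>M\<^esub>"
      using disj by blast
    then show ?thesis
      using car by (metis M.add.inv_closed M.minus_equality M.minus_minus)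
  qed
  \<comment> \<open>The value is the \<open>K\<close>-component along \<open>N\<close>; restricting
    to \<open>carrier M\<close> gives the extensionality that \<open>module_Hom\<close>
    demands.\<close>
  define f where "f = (\<lambda>m\<in>carrier M. THE k. k \<in> K \<and> (\<exists>n\<in>N. m = n \<oplus>\<^bsub>M\<^esub> k))"
  have f_eq: "f (n \<oplus>\<^bsub>M\<^esub> k) = k" if "n \<in> N" "k \<in> K" for n k
  proof -
    have "n \<oplus>\<^bsub>M\<^esub> k \<in> carrier M"
      using that sub by auto
    moreover have "(THE l. l \<in> K \<and> (\<exists>n'\<in>N. n \<oplus>\<^bsub>M\<^esub> k = n' \<oplus>\<^bsub>M\<^esub> l)) = k"
      using that unique by (intro the_equality) blast+
    ultimately show ?thesis
      by (simp add: f_def)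
  qed
  have split: "\<exists>n\<in>N. \<exists>k\<in>K. m = n \<oplus>\<^bsub>M\<^esub> k" if "m \<in> carrier M" for m
    using that unfolding sum[symmetric] mem_set_add_iff .
  have "f \<in> module_Hom R M (M\<lparr>carrier := K\<rparr>)"
    unfolding module_Hom_def
  proof (intro CollectI conjI ballI)
    have "f m \<in> K" if "m \<in> carrier M" for m
      using split[OF that] f_eq by auto
    moreover have "f \<in> extensional (carrier M)"
      by (simp add: f_def)
    ultimately show "f \<in> carrier M \<rightarrow>\<^sub>E carrier (M\<lparr>carrier := K\<rparr>)"
      by (auto simp: PiE_def)
    fix x assume "x \<in> carrier M"
    then obtain n k where x: "n \<in> N" "k \<in> K" "x = n \<oplus>\<^bsub>M\<^esub> k"
      using split by blast
    show "f (x \<oplus>\<^bsub>M\<^esub> y) = f x \<oplus>\<^bsub>M\<lparr>carrier := K\<rparr>\<^esub> f y" if "y \<in> carrier M" for y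
    proof -
      obtain n' k' where y: "n' \<in> N" "k' \<in> K" "y = n' \<oplus>\<^bsub>M\<^esub> k'"
        using split[OF \<open>y \<in> carrier M\<close>] by blast
      have "x \<oplus>\<^bsub>M\<^esub> y = (n \<oplus>\<^bsub>M\<^esub> n') \<oplus>\<^bsub>M\<^esub> (k \<oplus>\<^bsub>M\<^esub> k')"
        using x y sub by (auto simp: M.a_ac subsetD)
      then show ?thesis
        using x y N K by (simp add: f_eq submodule_iff)
    qed
    show "f (a \<odot>\<^bsub>M\<^esub> x) = a \<odot>\<^bsub>M\<lparr>carrier := K\<rparr>\<^esub> f x" if "a \<in> carrier R" for a
    proof -
      have "a \<odot>\<^bsub>M\<^esub> x = a \<odot>\<^bsub>M\<^esub> n \<oplus>\<^bsub>M\<^esub> a \<odot>\<^bsub>M\<^esub> k"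
        using x sub that by (auto simp: smult_r_distr subsetD)
      then show ?thesis
        using x that N K by (simp add: f_eq submodule_iff)
    qed
  qed
  moreover have "f k = k" if "k \<in> K" for k
  proof -
    have "f (\<zero>\<^bsub>M\<^esub> \<oplus>\<^bsub>M\<^esub> k) = k"
      using N that by (intro f_eq) (auto simp: submodule_iff)
    then show ?thesis
      using that sub by auto
  qed
  ultimately show thesis
    by (rule that)
qed

end

section \<open>Images and preimages under homomorphisms\<close>

locale left_module_hom = M: left_module R M + N: left_module R N
  for R (structure) and M and N +
  fixes f
  assumes hom: "f \<in> module_Hom R M N"
begin

lemma hom_closed [simp]: "x \<in> carrier M \<Longrightarrow> f x \<in> carrier N"
  using hom by (auto simp: module_Hom_def)

lemma hom_add [simp]:
  "x \<in> carrier M \<Longrightarrow> y \<in> carrier M \<Longrightarrow> f (x \<oplus>\<^bsub>M\<^esub> y) = f x \<oplus>\<^bsub>N\<^esub> f y"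
  using hom by (simp add: module_Hom_def)

lemma hom_smult [simp]:
  "a \<in> carrier R \<Longrightarrow> x \<in> carrier M \<Longrightarrow> f (a \<odot>\<^bsub>M\<^esub> x) = a \<odot>\<^bsub>N\<^esub> f x"
  using hom by (simp add: module_Hom_def)

lemma hom_zero [simp]: "f \<zero>\<^bsub>M\<^esub> = \<zero>\<^bsub>N\<^esub>"
  by (metis M.M.zero_closed M.R.zero_closed M.smult_l_zero N.smult_l_zero hom_closed hom_smult)

lemma submodule_vimage:
  assumes "submodule P R N"
  shows "submodule {x \<in> carrier M. f x \<in> P} R M"
  using assms by (auto simp: M.submodule_iff N.submodule_iff)

lemma submodule_image:
  assumes S: "submodule S R M"
  shows "submodule (f ` S) R N"
  unfolding N.submodule_iff
proof (intro conjI ballI)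
  have sub: "S \<subseteq> carrier M"
    using S by (simp add: M.submodule_iff)
  then show "f ` S \<subseteq> carrier N"
    by auto
  show "\<zero>\<^bsub>N\<^esub> \<in> f ` S"
    using S by (auto simp: M.submodule_iff intro: image_eqI[where x = "\<zero>\<^bsub>M\<^esub>"])
  show "x \<oplus>\<^bsub>N\<^esub> y \<in> f ` S" if "x \<in> f ` S" "y \<in> f ` S" for x y
  proof -
    from that obtain u v where "u \<in> S" "v \<in> S" "x = f u" "y = f v"
      by blast
    then show ?thesis
      using S sub by (intro image_eqI[where x = "u \<oplus>\<^bsub>M\<^esub> v"]) (auto simp: M.submodule_iff subsetD)
  qed
  show "a \<odot>\<^bsub>N\<^esub> x \<in> f ` S" if "a \<in> carrier R" "x \<in> f ` S" for a x
  proof -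
    from that obtain u where "u \<in> S" "x = f u"
      by blast
    then show ?thesis
      using S sub that(1)
      by (intro image_eqI[where x = "a \<odot>\<^bsub>M\<^esub> u"]) (auto simp: M.submodule_iff subsetD)
  qed
qed

text \<open>A submodule \<open>L\<close> of the image is the image of its preimage in
  \<open>S\<close>, and simplicity of \<open>S\<close> leaves only two choices for that
  preimage.\<close>

lemma simple_image:
  assumes S: "submodule S R M" and simple: "simple_module R (M\<lparr>carrier := S\<rparr>)"
    and ne: "f ` S \<noteq> {\<zero>\<^bsub>N\<^esub>}"
  shows "simple_module R (N\<lparr>carrier := f ` S\<rparr>)"
  unfolding N.simple_submodule_iff[OF submodule_image[OF S]]
proof (intro conjI allI impI)
  fix L assume L: "submodule L R N \<and> L \<subseteq> f ` S"
  let ?V = "{x \<in> carrier M. f x \<in> L} \<inter> S"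
  have "submodule ?V R M"
    using L S by (intro M.submodule_Int submodule_vimage) auto
  then have "?V = {\<zero>\<^bsub>M\<^esub>} \<or> ?V = S"
    using simple unfolding M.simple_submodule_iff[OF S] by (metis inf.cobounded2)
  moreover have "L = f ` ?V"
    using L S by (auto simp: M.submodule_iff)
  ultimately show "L = {\<zero>\<^bsub>N\<^esub>} \<or> L = f ` S"
    by auto
qed (rule ne)

text \<open>If \<open>a m\<close> lands in the preimage, then \<open>a f(m)\<close> is in
  \<open>P\<close>; so either \<open>f m\<close> is in \<open>P\<close>, or \<open>a\<close> sends
  all of \<open>N\<close> into \<open>P\<close> and hence all of \<open>M\<close> into the
  preimage.\<close>

lemma completely_prime_vimage:
  assumes "completely_prime_submodule P R N" and "{x \<in> carrier M. f x \<in> P} \<noteq> carrier M"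
  shows "completely_prime_submodule {x \<in> carrier M. f x \<in> P} R M"
  unfolding M.completely_prime_submodule_iff
proof (intro conjI ballI impI)
  show "submodule {x \<in> carrier M. f x \<in> P} R M"
    using assms(1) by (intro submodule_vimage) (simp add: N.completely_prime_submodule_iff)
  fix a m
  assume a: "a \<in> carrier R" and m: "m \<in> carrier M"
    and am: "a \<odot>\<^bsub>M\<^esub> m \<in> {x \<in> carrier M. f x \<in> P}"
  then have "f m \<in> P \<or> (\<forall>y\<in>carrier N. a \<odot>\<^bsub>N\<^esub> y \<in> P)"
    using assms(1) unfolding N.completely_prime_submodule_iff by simp
  then show "m \<in> {x \<in> carrier M. f x \<in> P} \<or>
      (\<forall>x\<in>carrier M. a \<odot>\<^bsub>M\<^esub> x \<in> {x \<in> carrier M. f x \<in> P})"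
    using a m by auto
qed (rule assms(2))

text \<open>The radical is functorial: the preimage of a completely prime submodule is everything or
  completely prime, and contains the radical of \<open>M\<close> in both cases.\<close>

lemma cp_radical_image: "f ` cp_radical R M \<subseteq> cp_radical R N"
proof -
  have "f x \<in> P" if x: "x \<in> cp_radical R M" and P: "completely_prime_submodule P R N" for x P
  proof (cases "{x \<in> carrier M. f x \<in> P} = carrier M")
    case True
    then show ?thesis
      using x by (auto simp: M.cp_radical_eq)
  next
    case False
    then show ?thesis
      using x completely_prime_vimage[OF P] by (auto simp: M.cp_radical_eq)
  qed
  then show ?thesis
    by (auto simp: N.cp_radical_eq) (auto simp: M.cp_radical_eq)
qed

end

section \<open>Heredity and idempotence on semisimple modules\<close>

context left_module
begin

text \<open>A complement gives a projection of \<open>M\<close> onto \<open>N\<close>, which sends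
  each simple submodule of \<open>M\<close> to zero or to a simple submodule of
  \<open>N\<close>.\<close>

lemma semisimple_submodule:
  assumes ss: "semisimple_module R M" and N: "submodule N R M"
  shows "semisimple_module R (M\<lparr>carrier := N\<rparr>)"
proof -
  let ?N = "M\<lparr>carrier := N\<rparr>"
  interpret N: left_module R ?N
    using N by (rule left_module_submodule)
  have "{\<zero>\<^bsub>M\<^esub>} \<subseteq> N"
    using N by (simp add: submodule_iff)
  then obtain K where K: "submodule K R M" "K \<inter> N = {\<zero>\<^bsub>M\<^esub>}" "K <+>\<^bsub>M\<^esub> N = carrier M"
    using semisimple_extend_submodule[OF ss N zero_submodule] by blast
  obtain f where f: "f \<in> module_Hom R M ?N" "\<And>n. n \<in> N \<Longrightarrow> f n = n"
    using projection_exists[OF K(1) N K(2,3)] by blast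
  interpret f: left_module_hom R M ?N f
    by (intro left_module_hom.intro left_module_hom_axioms.intro left_module_axioms
        N.left_module_axioms f)
  have "N \<subseteq> L" if L: "submodule L R ?N"
    "\<And>S. submodule S R ?N \<Longrightarrow> simple_module R (?N\<lparr>carrier := S\<rparr>) \<Longrightarrow> S \<subseteq> L" for L
  proof -
    \<comment> \<open>If \<open>L\<close> contains the simple submodules of \<open>N\<close>, its
      preimage contains those of \<open>M\<close>, so it is everything; as \<open>f\<close> fixes
      \<open>N\<close>, this gives \<open>N \<subseteq> L\<close>.\<close>
    have "{x \<in> carrier M. f x \<in> L} = carrier M"
    proof (rule semisimple_submodule_eq_carrier[OF ss f.submodule_vimage[OF L(1)]])
      fix S assume S: "submodule S R M" and simple: "simple_module R (M\<lparr>carrier := S\<rparr>)"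
      have "f ` S \<subseteq> L"
      proof (cases "f ` S = {\<zero>\<^bsub>M\<^esub>}")
        case True
        then show ?thesis
          using L(1) by (simp add: N.submodule_iff)
      next
        case False
        then show ?thesis
          using f.simple_image[OF S simple] f.submodule_image[OF S] L(2) by simp
      qed
      then show "S \<subseteq> {x \<in> carrier M. f x \<in> L}"
        using S by (auto simp: submodule_iff)
    qed
    moreover have "N \<subseteq> carrier M"
      using N by (simp add: submodule_iff)
    ultimately have "f n \<in> L" if "n \<in> N" for n
      using that by blast
    then show ?thesis
      using f(2) by auto
  qed
  then have "N \<subseteq> submodule_sum R ?N {S. submodule S R ?N \<and> simple_module R (?N\<lparr>carrier := S\<rparr>)}"
    unfolding submodule_sum_def by (intro Inter_greatest) blast
  moreover have "submodule_sum R ?N {S. submodule S R ?N \<and> simple_module R (?N\<lparr>carrier := S\<rparr>)} \<subseteq> N"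
    unfolding submodule_sum_def
    using N.carrier_submodule by (intro Inter_lower) (auto simp: submodule_submodule_iff[OF N])
  ultimately
  have "submodule_sum R ?N {S. submodule S R ?N \<and> simple_module R (?N\<lparr>carrier := S\<rparr>)} = N"
    by blast
  then show ?thesis
    unfolding semisimple_module_def using N.left_module_axioms by simp
qed

text \<open>Functoriality of the radical, applied to the inclusion of \<open>N\<close>.\<close>

lemma cp_radical_submodule_subset:
  assumes N: "submodule N R M"
  shows "cp_radical R (M\<lparr>carrier := N\<rparr>) \<subseteq> N \<inter> cp_radical R M"
proof -
  interpret N: left_module R "M\<lparr>carrier := N\<rparr>"
    using N by (rule left_module_submodule)
  interpret i: left_module_hom R "M\<lparr>carrier := N\<rparr>" M "\<lambda>x\<in>N. x"
    by (intro left_module_hom.intro left_module_hom_axioms.intro left_module_axioms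
        N.left_module_axioms module_Hom_inclusion N)
  have "cp_radical R (M\<lparr>carrier := N\<rparr>) \<subseteq> N"
    by (auto simp: N.cp_radical_eq)
  then show ?thesis
    using i.cp_radical_image by auto
qed

theorem cp_radical_hereditary:
  assumes ss: "semisimple_module R M" and N: "submodule N R M"
  shows "cp_radical R (M\<lparr>carrier := N\<rparr>) = N \<inter> cp_radical R M"
proof
  show "cp_radical R (M\<lparr>carrier := N\<rparr>) \<subseteq> N \<inter> cp_radical R M"
    using N by (rule cp_radical_submodule_subset)
  interpret N: left_module R "M\<lparr>carrier := N\<rparr>"
    using N by (rule left_module_submodule)
  have "x \<in> P" if x: "x \<in> N" "x \<in> cp_radical R M"
    and P: "completely_prime_submodule P R (M\<lparr>carrier := N\<rparr>)" for x P
  proof -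
    have P': "submodule P R M" "P \<subseteq> N" "P \<noteq> N"
      "\<And>a m y. a \<in> carrier R \<Longrightarrow> m \<in> N \<Longrightarrow> a \<odot>\<^bsub>M\<^esub> m \<in> P \<Longrightarrow> m \<notin> P \<Longrightarrow> y \<in> N \<Longrightarrow> a \<odot>\<^bsub>M\<^esub> y \<in> P"
      using P unfolding N.completely_prime_submodule_iff submodule_submodule_iff[OF N] by auto
    obtain Q where Q: "submodule Q R M" "Q \<inter> N = P" "Q <+>\<^bsub>M\<^esub> N = carrier M"
      using semisimple_extend_submodule[OF ss N P'(1,2)] by blast
    \<comment> \<open>This is the isomorphism of \<open>M/Q\<close> with \<open>N/P\<close> in
      elementwise form: modulo \<open>Q\<close> only the \<open>N\<close>-component matters, and
      \<open>Q \<inter> N = P\<close>.\<close>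
    have smult_iff: "a \<odot>\<^bsub>M\<^esub> (q \<oplus>\<^bsub>M\<^esub> n) \<in> Q \<longleftrightarrow> a \<odot>\<^bsub>M\<^esub> n \<in> P"
      if "a \<in> carrier R" "q \<in> Q" "n \<in> N" for a q n
    proof -
      have car: "q \<in> carrier M" "n \<in> carrier M" "a \<odot>\<^bsub>M\<^esub> n \<in> N" "a \<odot>\<^bsub>M\<^esub> q \<in> Q"
        using that Q(1) N by (auto simp: submodule_iff)
      then have "a \<odot>\<^bsub>M\<^esub> (q \<oplus>\<^bsub>M\<^esub> n) \<in> Q \<longleftrightarrow> a \<odot>\<^bsub>M\<^esub> n \<in> Q"
        using that by (simp add: smult_r_distr submodule_add_cancel[OF Q(1)])
      then show ?thesis
        using car Q(2) by blast
    qed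
    have split: "\<exists>q\<in>Q. \<exists>n\<in>N. m = q \<oplus>\<^bsub>M\<^esub> n" if "m \<in> carrier M" for m
      using that unfolding Q(3)[symmetric] mem_set_add_iff .
    have "completely_prime_submodule Q R M"
      unfolding completely_prime_submodule_iff
    proof (intro conjI ballI impI)
      show "submodule Q R M" "Q \<noteq> carrier M"
        using Q P' N by (auto simp: submodule_iff)
      fix a m assume a: "a \<in> carrier R" and m: "m \<in> carrier M" and am: "a \<odot>\<^bsub>M\<^esub> m \<in> Q"
      obtain q n where qn: "q \<in> Q" "n \<in> N" "m = q \<oplus>\<^bsub>M\<^esub> n"
        using split[OF m] by blast
      show "m \<in> Q \<or> (\<forall>y\<in>carrier M. a \<odot>\<^bsub>M\<^esub> y \<in> Q)"
      \<comment> \<open>Outside \<open>P\<close>, complete primeness in \<open>N\<close> applies to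
        \<open>n\<close> and makes \<open>a\<close> send all of \<open>N\<close> into
        \<open>P\<close>; \<open>smult_iff\<close> carries this over to \<open>M\<close> and
        \<open>Q\<close>.\<close>
      proof (cases "n \<in> P")
        case True
        then have "m \<in> Q"
          using qn Q(1,2) by (auto simp: submodule_iff)
        then show ?thesis ..
      next
        case False
        have "a \<odot>\<^bsub>M\<^esub> n \<in> P"
          using am qn a smult_iff by simp
        then have "a \<odot>\<^bsub>M\<^esub> y \<in> Q" if "y \<in> carrier M" for y
          using split[OF that] smult_iff[OF a] P'(4)[OF a qn(2) _ False] by auto
        then show ?thesis
          by blast
      qed
    qed
    then have "x \<in> Q"
      using x by (simp add: cp_radical_eq)
    then show ?thesis
      using x Q(2) by blast
  qed
  then show "N \<inter> cp_radical R M \<subseteq> cp_radical R (M\<lparr>carrier := N\<rparr>)"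
    by (auto simp: N.cp_radical_eq)
qed

theorem cp_radical_idempotent:
  assumes "semisimple_module R M"
  shows "cp_radical R (M\<lparr>carrier := cp_radical R M\<rparr>) = cp_radical R M"
  using cp_radical_hereditary[OF assms submodule_cp_radical] by simp

text \<open>Requiring \<open>f\<close> to fix \<open>K\<close> pointwise lets a vanishing projection
  force \<open>K\<close> to be zero.\<close>

lemma semisimple_cp_radical_complement:
  assumes ss: "semisimple_module R M"
  obtains K f where "submodule K R M" and "cp_radical R (M\<lparr>carrier := K\<rparr>) = {\<zero>\<^bsub>M\<^esub>}"
    and "cp_radical R M <+>\<^bsub>M\<^esub> K = carrier M"
    and "f \<in> module_Hom R M (M\<lparr>carrier := K\<rparr>)" and "\<And>k. k \<in> K \<Longrightarrow> f k = k"
proof -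
  let ?B = "cp_radical R M"
  note B = submodule_cp_radical
  have "{\<zero>\<^bsub>M\<^esub>} \<subseteq> ?B"
    using B by (simp add: submodule_iff)
  then obtain K where K: "submodule K R M" "K \<inter> ?B = {\<zero>\<^bsub>M\<^esub>}" "K <+>\<^bsub>M\<^esub> ?B = carrier M"
    using semisimple_extend_submodule[OF ss B zero_submodule] by blast
  \<comment> \<open>The projection onto \<open>K\<close> needs \<open>K\<close> as the second
    summand, hence the swap.\<close>
  have sum: "?B <+>\<^bsub>M\<^esub> K = carrier M"
  proof -
    have "?B <+>\<^bsub>M\<^esub> K = K <+>\<^bsub>M\<^esub> ?B"
      using B K(1) M.a_comm unfolding submodule_iff set_eq_iff mem_set_add_iff by (metis subsetD)
    then show ?thesis
      using K(3) by simp
  qed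
  obtain f where "f \<in> module_Hom R M (M\<lparr>carrier := K\<rparr>)" "\<And>k. k \<in> K \<Longrightarrow> f k = k"
    using projection_exists[OF B K(1) _ sum] K(2) by (metis Int_commute)
  then show thesis
    using that K(1,2) sum cp_radical_hereditary[OF ss K(1)] by metis
qed

end

section \<open>The torsion theory\<close>

text \<open>By functoriality a homomorphism maps the radical of \<open>T\<close>, which is all of
  \<open>T\<close>, into the zero radical of \<open>F\<close>.\<close>

lemma module_Hom_radical_radicalfree:
  assumes T: "left_module R T" "cp_radical R T = carrier T"
    and F: "left_module R F" "cp_radical R F = {\<zero>\<^bsub>F\<^esub>}"
  shows "module_Hom R T F = {zero_hom T F}"
proof -
  interpret T: left_module R T by fact
  interpret F: left_module R F by fact
  have "f = zero_hom T F" if f: "f \<in> module_Hom R T F" for f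
  proof -
    interpret left_module_hom R T F f
      by unfold_locales (rule f)
    have "f ` carrier T \<subseteq> {\<zero>\<^bsub>F\<^esub>}"
      using cp_radical_image T(2) F(2) by simp
    moreover have "f \<in> extensional (carrier T)"
      using f by (simp add: module_Hom_def PiE_iff)
    ultimately show ?thesis
      unfolding zero_hom_def by (intro extensionalityI[where A = "carrier T"]) auto
  qed
  moreover have "zero_hom T F \<in> module_Hom R T F"
    by (auto simp: module_Hom_def zero_hom_def)
  ultimately show ?thesis
    by blast
qed

theorem theorem5p2:
  fixes R :: "('a, 'r) ring_scheme"
  assumes "ring R"
  shows "(\<forall>(M :: ('a, 'b) module) N. semisimple_module R M \<and> submodule N R M \<longrightarrow>
            cp_radical R (M\<lparr>carrier := N\<rparr>) = N \<inter> cp_radical R M)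
       \<and> torsion_theory R
            {M :: ('a, 'b) module. semisimple_module R M}
            {M. semisimple_module R M \<and> cp_radical R M = carrier M}
            {M. semisimple_module R M \<and> cp_radical R M = {\<zero>\<^bsub>M\<^esub>}}
       \<and> (\<forall>M :: ('a, 'b) module. semisimple_module R M \<longrightarrow>
            cp_radical R (M\<lparr>carrier := cp_radical R M\<rparr>) = cp_radical R M)"
proof (intro conjI allI impI)
  have lm: "left_module R M" if "semisimple_module R M" for M :: "('a, 'b) module"
    using that by (simp add: semisimple_module_def)
  show "cp_radical R (M\<lparr>carrier := N\<rparr>) = N \<inter> cp_radical R M"
    if "semisimple_module R M \<and> submodule N R M" for M :: "('a, 'b) module" and N
    using that lm left_module.cp_radical_hereditary by blast
  show "cp_radical R (M\<lparr>carrier := cp_radical R M\<rparr>) = cp_radical R M"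
    if "semisimple_module R M" for M :: "('a, 'b) module"
    using that lm left_module.cp_radical_idempotent by blast
  show "torsion_theory R
            {M :: ('a, 'b) module. semisimple_module R M}
            {M. semisimple_module R M \<and> cp_radical R M = carrier M}
            {M. semisimple_module R M \<and> cp_radical R M = {\<zero>\<^bsub>M\<^esub>}}"
    unfolding torsion_theory_def
  proof (intro conjI ballI impI)
    fix T F :: "('a, 'b) module"
    assume "T \<in> {M :: ('a, 'b) module. semisimple_module R M \<and> cp_radical R M = carrier M}"
      and "F \<in> {M :: ('a, 'b) module. semisimple_module R M \<and> cp_radical R M = {\<zero>\<^bsub>M\<^esub>}}"
    then show "module_Hom R T F = {zero_hom T F}"
      using lm by (intro module_Hom_radical_radicalfree) auto
  next
    fix C :: "('a, 'b) module"
    assume "C \<in> {M :: ('a, 'b) module. semisimple_module R M}"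
      and hom: "\<forall>F\<in>{M :: ('a, 'b) module. semisimple_module R M \<and> cp_radical R M = {\<zero>\<^bsub>M\<^esub>}}.
        module_Hom R C F = {zero_hom C F}"
    then have ss: "semisimple_module R C"
      by simp
    interpret C: left_module R C
      using ss by (rule lm)
    obtain K f where K: "submodule K R C" "cp_radical R (C\<lparr>carrier := K\<rparr>) = {\<zero>\<^bsub>C\<^esub>}"
        "cp_radical R C <+>\<^bsub>C\<^esub> K = carrier C"
      and f: "f \<in> module_Hom R C (C\<lparr>carrier := K\<rparr>)" "\<And>k. k \<in> K \<Longrightarrow> f k = k"
      using C.semisimple_cp_radical_complement[OF ss] by blast
    \<comment> \<open>The complement is a torsion-free module over the same carrier type, so
      \<open>hom\<close> applies to it and the projection vanishes.\<close>
    have "C\<lparr>carrier := K\<rparr> \<in> {M :: ('a, 'b) module. semisimple_module R M \<and> cp_radical R M = {\<zero>\<^bsub>M\<^esub>}}"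
      using K(2) C.semisimple_submodule[OF ss K(1)] by simp
    then have "f = zero_hom C (C\<lparr>carrier := K\<rparr>)"
      using hom f(1) by blast
    then have K0: "k = \<zero>\<^bsub>C\<^esub>" if "k \<in> K" for k
      using f(2)[OF that] that K(1) by (auto simp: zero_hom_def C.submodule_iff)
    have "carrier C \<subseteq> cp_radical R C"
    proof
      fix x assume "x \<in> carrier C"
      then obtain b k where "b \<in> cp_radical R C" "k \<in> K" "x = b \<oplus>\<^bsub>C\<^esub> k"
        unfolding K(3)[symmetric] C.mem_set_add_iff by blast
      then show "x \<in> cp_radical R C"
        using K0[of k] C.submodule_cp_radical by (auto simp: C.submodule_iff)
    qed
    then show "C \<in> {M :: ('a, 'b) module. semisimple_module R M \<and> cp_radical R M = carrier M}"
      using ss by (auto simp: C.cp_radical_eq)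
  next
    fix C :: "('a, 'b) module"
    assume "C \<in> {M :: ('a, 'b) module. semisimple_module R M}"
      and hom: "\<forall>T\<in>{M :: ('a, 'b) module. semisimple_module R M \<and> cp_radical R M = carrier M}.
        module_Hom R T C = {zero_hom T C}"
    then have ss: "semisimple_module R C"
      by simp
    interpret C: left_module R C
      using ss by (rule lm)
    let ?B = "cp_radical R C"
    note B = C.submodule_cp_radical
    \<comment> \<open>By idempotence the radical is itself a torsion module; its inclusion into
      \<open>C\<close> is therefore zero, so the radical is zero.\<close>
    have "module_Hom R (C\<lparr>carrier := ?B\<rparr>) C = {zero_hom (C\<lparr>carrier := ?B\<rparr>) C}"
      using hom C.semisimple_submodule[OF ss B] C.cp_radical_idempotent[OF ss] by simp
    then have "(\<lambda>x\<in>?B. x) = zero_hom (C\<lparr>carrier := ?B\<rparr>) C"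
      using C.module_Hom_inclusion[OF B] by simp
    then have "x = \<zero>\<^bsub>C\<^esub>" if "x \<in> ?B" for x
      using that by (auto simp: zero_hom_def dest: fun_cong[where x = x])
    then show "C \<in> {M :: ('a, 'b) module. semisimple_module R M \<and> cp_radical R M = {\<zero>\<^bsub>M\<^esub>}}"
      using ss B by (auto simp: C.submodule_iff)
  qed auto
qed

end
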